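(* Let $(X,\mathcal{A})$ be a measurable space. The Banach space $\mathcal{M}^*(X,\mathcal{A})$, with the supremum norm, is reflexive if and only if $\mathcal{A}$ is finite.
   Context: A measurable space $(X,\mathcal{A})$ is a nonempty set $X$ with a $\sigma$-algebra $\mathcal{A}$ of subsets of $X$. $\mathcal{M}^*(X,\mathcal{A})$ is the real Banach space of all bounded $\mathcal{A}$-measurable functions $f:X\to\mathbb{R}$ with the supremum norm. *)

theory Defs
  imports "HOL-Analysis.Analysis"
begin

text \<open>
  The space of bounded measurable functions depends on a measurable space given as a term,
  so it is not a type and the type-class based normed spaces and \<open>blinfun\<close> do not apply.
  Normed spaces, duals and reflexivity are therefore set up on explicit carriers.
\<close>

record 'v normed_str =
  vectors :: "'v set"
  vzero :: 'v
  vadd :: "'v \<Rightarrow> 'v \<Rightarrow> 'v"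
  vscale :: "real \<Rightarrow> 'v \<Rightarrow> 'v"
  vnorm :: "'v \<Rightarrow> real"

locale real_normed_space =
  fixes E :: "'v normed_str"
  assumes zero_closed: "vzero E \<in> vectors E"
    and add_closed: "\<lbrakk>x \<in> vectors E; y \<in> vectors E\<rbrakk> \<Longrightarrow> vadd E x y \<in> vectors E"
    and scale_closed: "x \<in> vectors E \<Longrightarrow> vscale E c x \<in> vectors E"
    and add_assoc: "\<lbrakk>x \<in> vectors E; y \<in> vectors E; z \<in> vectors E\<rbrakk> \<Longrightarrow>
      vadd E (vadd E x y) z = vadd E x (vadd E y z)"
    and add_commute: "\<lbrakk>x \<in> vectors E; y \<in> vectors E\<rbrakk> \<Longrightarrow> vadd E x y = vadd E y x"
    and add_zero: "x \<in> vectors E \<Longrightarrow> vadd E x (vzero E) = x"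
    and add_neg: "x \<in> vectors E \<Longrightarrow> vadd E x (vscale E (- 1) x) = vzero E"
    and scale_one: "x \<in> vectors E \<Longrightarrow> vscale E 1 x = x"
    and scale_scale: "x \<in> vectors E \<Longrightarrow> vscale E a (vscale E b x) = vscale E (a * b) x"
    and scale_add: "\<lbrakk>x \<in> vectors E; y \<in> vectors E\<rbrakk> \<Longrightarrow>
      vscale E a (vadd E x y) = vadd E (vscale E a x) (vscale E a y)"
    and add_scale: "x \<in> vectors E \<Longrightarrow> vscale E (a + b) x = vadd E (vscale E a x) (vscale E b x)"
    and norm_eq_zero: "x \<in> vectors E \<Longrightarrow> vnorm E x = 0 \<longleftrightarrow> x = vzero E"
    and norm_scale: "x \<in> vectors E \<Longrightarrow> vnorm E (vscale E a x) = \<bar>a\<bar> * vnorm E x"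
    and norm_triangle: "\<lbrakk>x \<in> vectors E; y \<in> vectors E\<rbrakk> \<Longrightarrow>
      vnorm E (vadd E x y) \<le> vnorm E x + vnorm E y"

definition vdist :: "'v normed_str \<Rightarrow> 'v \<Rightarrow> 'v \<Rightarrow> real" where
  "vdist E x y = vnorm E (vadd E x (vscale E (- 1) y))"

locale real_banach_space = real_normed_space +
  assumes complete: "\<lbrakk>\<And>n::nat. s n \<in> vectors E;
      \<And>e. e > 0 \<Longrightarrow> \<exists>N. \<forall>m\<ge>N. \<forall>n\<ge>N. vdist E (s m) (s n) < e\<rbrakk> \<Longrightarrow>
      \<exists>x\<in>vectors E. (\<lambda>n. vdist E (s n) x) \<longlonglongrightarrow> 0"

text \<open>
  Functionals on \<open>E\<close> are extensional (\<open>undefined\<close> off \<open>vectors E\<close>), so that equality in the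
  dual is equality on \<open>vectors E\<close>.
\<close>

definition bounded_functional :: "'v normed_str \<Rightarrow> ('v \<Rightarrow> real) \<Rightarrow> bool" where
  "bounded_functional E \<phi> \<longleftrightarrow>
     \<phi> \<in> extensional (vectors E) \<and>
     (\<forall>x\<in>vectors E. \<forall>y\<in>vectors E. \<phi> (vadd E x y) = \<phi> x + \<phi> y) \<and>
     (\<forall>c. \<forall>x\<in>vectors E. \<phi> (vscale E c x) = c * \<phi> x) \<and>
     (\<exists>K. \<forall>x\<in>vectors E. \<bar>\<phi> x\<bar> \<le> K * vnorm E x)"

definition dual_space :: "'v normed_str \<Rightarrow> ('v \<Rightarrow> real) normed_str" where
  "dual_space E =
     \<lparr>vectors = {\<phi>. bounded_functional E \<phi>},
      vzero = (\<lambda>x\<in>vectors E. 0),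
      vadd = (\<lambda>\<phi> \<psi>. \<lambda>x\<in>vectors E. \<phi> x + \<psi> x),
      vscale = (\<lambda>c \<phi>. \<lambda>x\<in>vectors E. c * \<phi> x),
      vnorm = (\<lambda>\<phi>. SUP x\<in>{x \<in> vectors E. vnorm E x \<le> 1}. \<bar>\<phi> x\<bar>)\<rparr>"

definition canonical_embedding :: "'v normed_str \<Rightarrow> 'v \<Rightarrow> ('v \<Rightarrow> real) \<Rightarrow> real" where
  "canonical_embedding E x = (\<lambda>\<phi>\<in>vectors (dual_space E). \<phi> x)"

definition reflexive_space :: "'v normed_str \<Rightarrow> bool" where
  "reflexive_space E \<longleftrightarrow>
     canonical_embedding E ` vectors E = vectors (dual_space (dual_space E))"

definition bounded_measurable_space :: "'a set \<Rightarrow> 'a set set \<Rightarrow> ('a \<Rightarrow> real) normed_str" where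
  "bounded_measurable_space X \<A> =
     \<lparr>vectors = {f \<in> extensional X. f \<in> borel_measurable (sigma X \<A>) \<and> bounded (f ` X)},
      vzero = (\<lambda>x\<in>X. 0),
      vadd = (\<lambda>f g. \<lambda>x\<in>X. f x + g x),
      vscale = (\<lambda>c f. \<lambda>x\<in>X. c * f x),
      vnorm = (\<lambda>f. SUP x\<in>X. \<bar>f x\<bar>)\<rparr>"

lemma bounded_measurable_space_norm_le_iff:
  assumes "X \<noteq> {}" "f \<in> vectors (bounded_measurable_space X \<A>)"
  shows "vnorm (bounded_measurable_space X \<A>) f \<le> K \<longleftrightarrow> (\<forall>x\<in>X. \<bar>f x\<bar> \<le> K)"
proof -
  have "bdd_above ((\<lambda>x. \<bar>f x\<bar>) ` X)"
    using assms(2) by (auto simp: bounded_measurable_space_def bounded_iff bdd_above_def)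
  then show ?thesis
    using assms(1) by (simp add: bounded_measurable_space_def cSUP_le_iff)
qed

lemma real_banach_space_bounded_measurable_space:
  assumes "sigma_algebra X \<A>" "X \<noteq> {}"
  shows "real_banach_space (bounded_measurable_space X \<A>)" (is "real_banach_space ?E")
proof -
  let ?S = "sigma X \<A>"
  have sp: "space ?S = X"
    using assms(1) by (simp add: sigma_algebra_iff2 space_measure_of)
  have mem: "f \<in> vectors ?E \<longleftrightarrow>
      f \<in> extensional X \<and> f \<in> borel_measurable ?S \<and> (\<exists>K. \<forall>x\<in>X. \<bar>f x\<bar> \<le> K)" for f
    by (auto simp: bounded_measurable_space_def bounded_iff)
  have meas: "restrict f X \<in> borel_measurable ?S" if "f \<in> borel_measurable ?S"
    for f :: "'a \<Rightarrow> real"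
    using that by (subst measurable_cong[where g = f]) (auto simp: sp)
  note le = bounded_measurable_space_norm_le_iff[OF assms(2)]
  have z: "vzero ?E = (\<lambda>x\<in>X. 0)" and a: "vadd ?E f g = (\<lambda>x\<in>X. f x + g x)"
    and s: "vscale ?E c f = (\<lambda>x\<in>X. c * f x)" for f g c
    by (simp_all add: bounded_measurable_space_def)
  have ub: "\<bar>f x\<bar> \<le> vnorm ?E f" if "f \<in> vectors ?E" "x \<in> X" for f x
    using le[OF that(1), of "vnorm ?E f"] that(2) by simp
  have nn: "0 \<le> vnorm ?E f" if "f \<in> vectors ?E" for f
    using ub[OF that] assms(2) abs_ge_zero order_trans by blast
  have zc: "vzero ?E \<in> vectors ?E"
    by (auto simp: mem z intro!: meas)
  have ac: "vadd ?E f g \<in> vectors ?E" if "f \<in> vectors ?E" "g \<in> vectors ?E" for f g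
  proof -
    have "\<bar>f x + g x\<bar> \<le> vnorm ?E f + vnorm ?E g" if "x \<in> X" for x
      using ub[OF \<open>f \<in> vectors ?E\<close> that] ub[OF \<open>g \<in> vectors ?E\<close> that] by linarith
    then have "\<exists>K. \<forall>x\<in>X. \<bar>vadd ?E f g x\<bar> \<le> K"
      unfolding a by (intro exI[of _ "vnorm ?E f + vnorm ?E g"]) simp
    moreover have "vadd ?E f g \<in> borel_measurable ?S"
      using that unfolding a mem by (intro meas borel_measurable_add) blast+
    ultimately show ?thesis
      unfolding mem by (simp add: a)
  qed
  have sc: "vscale ?E c f \<in> vectors ?E" if "f \<in> vectors ?E" for c f
  proof -
    have "\<bar>c * f x\<bar> \<le> \<bar>c\<bar> * vnorm ?E f" if "x \<in> X" for x
      using ub[OF \<open>f \<in> vectors ?E\<close> that] by (simp add: abs_mult mult_left_mono)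
    then have "\<exists>K. \<forall>x\<in>X. \<bar>vscale ?E c f x\<bar> \<le> K"
      unfolding s by (intro exI[of _ "\<bar>c\<bar> * vnorm ?E f"]) simp
    moreover have "vscale ?E c f \<in> borel_measurable ?S"
      using that unfolding s mem by (intro meas borel_measurable_times borel_measurable_const) blast
    ultimately show ?thesis
      unfolding mem by (simp add: s)
  qed
  have sle: "vnorm ?E (vscale ?E c f) \<le> \<bar>c\<bar> * vnorm ?E f" if "f \<in> vectors ?E" for c f
    using ub[OF that] by (simp add: le[OF sc[OF that]]) (simp add: s abs_mult mult_left_mono)
  have ext: "f = g" if "f \<in> vectors ?E" "g \<in> vectors ?E" "\<And>x. x \<in> X \<Longrightarrow> f x = g x" for f g
    using that by (auto simp: mem intro: extensionalityI)
  have ns: "real_normed_space ?E"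
  proof
    show "vnorm ?E f = 0 \<longleftrightarrow> f = vzero ?E" if f: "f \<in> vectors ?E" for f
    proof
      assume "vnorm ?E f = 0"
      then show "f = vzero ?E"
        using ub[OF f] by (intro ext[OF f zc]) (simp add: z)
    next
      assume *: "f = vzero ?E"
      have "vnorm ?E f \<le> 0"
        unfolding le[OF f] by (simp add: * z)
      then show "vnorm ?E f = 0"
        using nn[OF f] by simp
    qed
    show "vnorm ?E (vscale ?E c f) = \<bar>c\<bar> * vnorm ?E f" if f: "f \<in> vectors ?E" for c f
    proof (cases "c = 0")
      case True
      then show ?thesis
        using sle[OF f, of c] nn[OF sc[OF f, of c]] by simp
    next
      case False
      have "vscale ?E (inverse c) (vscale ?E c f) = f"
        by (rule ext[OF sc[OF sc[OF f]] f]) (use False in \<open>simp add: s\<close>)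
      then have "vnorm ?E f \<le> \<bar>inverse c\<bar> * vnorm ?E (vscale ?E c f)"
        using sle[OF sc[OF f], of "inverse c" c] by simp
      then show ?thesis
        using sle[OF f, of c] False by (simp add: field_simps)
    qed
    show "vnorm ?E (vadd ?E f g) \<le> vnorm ?E f + vnorm ?E g"
      if f: "f \<in> vectors ?E" and g: "g \<in> vectors ?E" for f g
      unfolding le[OF ac[OF f g]]
    proof
      fix x assume "x \<in> X"
      then show "\<bar>vadd ?E f g x\<bar> \<le> vnorm ?E f + vnorm ?E g"
        using ub[OF f \<open>x \<in> X\<close>] ub[OF g \<open>x \<in> X\<close>] by (simp add: a)
    qed
    show "vscale ?E 1 f = f" if f: "f \<in> vectors ?E" for f
      by (rule ext[OF sc[OF f] f]) (simp add: s)
    show "vadd ?E f (vzero ?E) = f" if f: "f \<in> vectors ?E" for f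
      by (rule ext[OF ac[OF f zc] f]) (simp add: a z)
  qed (simp_all only: zc ac sc, simp_all only: a s z, (rule restrict_ext, simp add: algebra_simps)+)
  show ?thesis
  proof (rule real_banach_space.intro[OF ns], unfold_locales)
    fix f :: "nat \<Rightarrow> 'a \<Rightarrow> real"
    assume f: "\<And>n. f n \<in> vectors ?E"
      and Cau: "\<And>e. e > 0 \<Longrightarrow> \<exists>N. \<forall>m\<ge>N. \<forall>n\<ge>N. vdist ?E (f m) (f n) < e"
    have df: "vdist ?E g h \<le> e \<longleftrightarrow> (\<forall>x\<in>X. \<bar>g x - h x\<bar> \<le> e)"
      if "g \<in> vectors ?E" "h \<in> vectors ?E" for g h e
      unfolding vdist_def le[OF ac[OF that(1) sc[OF that(2)]]] by (simp add: a s)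
    have uC: "uniformly_Cauchy_on X f"
      unfolding uniformly_Cauchy_on_def
    proof (intro allI impI)
      fix e :: real assume "e > 0"
      then obtain N where N: "\<forall>m\<ge>N. \<forall>n\<ge>N. vdist ?E (f m) (f n) < e / 2"
        using Cau[of "e / 2"] by auto
      have "dist (f m x) (f n x) < e" if "x \<in> X" "m \<ge> N" "n \<ge> N" for x m n
      proof -
        have "vdist ?E (f m) (f n) \<le> e / 2"
          using N that by (simp add: less_imp_le)
        then have "\<bar>f m x - f n x\<bar> \<le> e / 2"
          using df[OF f f] that by blast
        then show ?thesis
          using \<open>e > 0\<close> by (simp add: dist_real_def)
      qed
      then show "\<exists>M. \<forall>x\<in>X. \<forall>m\<ge>M. \<forall>n\<ge>M. dist (f m x) (f n x) < e"
        by blast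
    qed
    then obtain l where l: "uniform_limit X f l sequentially"
      using Cauchy_uniformly_convergent uniformly_convergent_on_def by blast
    define g where "g = restrict l X"
    have ev: "\<exists>N. \<forall>n\<ge>N. \<forall>x\<in>X. \<bar>f n x - g x\<bar> \<le> e" if "e > 0" for e
    proof -
      obtain N where "\<forall>n\<ge>N. \<forall>x\<in>X. dist (f n x) (l x) < e"
        using uniform_limitD[OF l \<open>e > 0\<close>] unfolding eventually_sequentially by blast
      then show ?thesis
        by (intro exI[of _ N]) (simp add: g_def dist_real_def less_imp_le)
    qed
    have pw: "(\<lambda>n. f n x) \<longlonglongrightarrow> g x" if "x \<in> X" for x
      using tendsto_uniform_limitI[OF l that] that by (simp add: g_def)
    have gm: "g \<in> borel_measurable ?S"
    proof (rule borel_measurable_LIMSEQ_real[of ?S f])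
      show "(\<lambda>n. f n x) \<longlonglongrightarrow> g x" if "x \<in> space ?S" for x
        using that unfolding sp by (rule pw)
      show "f n \<in> borel_measurable ?S" for n
        using f[of n] unfolding mem by blast
    qed
    obtain N where N: "\<forall>x\<in>X. \<bar>f N x - g x\<bar> \<le> 1"
      using ev[of 1] by auto
    have "\<bar>g x\<bar> \<le> vnorm ?E (f N) + 1" if "x \<in> X" for x
      using ub[OF f that, of N] bspec[OF N that] by linarith
    then have "\<exists>K. \<forall>x\<in>X. \<bar>g x\<bar> \<le> K"
      by blast
    moreover have "g \<in> extensional X"
      by (simp add: g_def)
    ultimately have g: "g \<in> vectors ?E"
      using gm unfolding mem by blast
    have "(\<lambda>n. vdist ?E (f n) g) \<longlonglongrightarrow> 0"
    proof (rule LIMSEQ_I)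
      fix e :: real assume "e > 0"
      then obtain N where N: "\<forall>n\<ge>N. \<forall>x\<in>X. \<bar>f n x - g x\<bar> \<le> e / 2"
        using ev[of "e / 2"] by auto
      have "norm (vdist ?E (f n) g - 0) < e" if "n \<ge> N" for n
      proof -
        have "vdist ?E (f n) g \<le> e / 2"
          unfolding df[OF f g] using N that by blast
        moreover have "0 \<le> vdist ?E (f n) g"
          unfolding vdist_def by (rule nn[OF ac[OF f sc[OF g]]])
        ultimately show ?thesis
          using \<open>e > 0\<close> by simp
      qed
      then show "\<exists>no. \<forall>n\<ge>no. norm (vdist ?E (f n) g - 0) < e"
        by blast
    qed
    with g show "\<exists>x\<in>vectors ?E. (\<lambda>n. vdist ?E (f n) x) \<longlonglongrightarrow> 0"
      by blast
  qed
qed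

end

(* If \<A> is finite, functions are spanned by the indicators of the atoms, with point evaluations as
   coordinate functionals, and a space with such a finite dual basis is reflexive.
   If \<A> is infinite, choose disjoint nonempty sets A n in \<A> and points x n in A n. On the dual,
   F \<mu> = (\<Sum>n. \<mu> (indicator (A n))) is bounded. If F were evaluation at f, testing F on the Dirac
   functionals would give f (x n) = 1 for all n. But a generalised limit \<mu> f = lim f (x n) along a
   filter satisfies \<mu> f = 1, while it kills every indicator (A n), so F \<mu> = 0. *)

theory Submission imports Defs begin

section \<open>Generalised limits: filters along which every bounded real family converges\<close>

text \<open>By compactness of products: sending \<open>i\<close> to all the values
  \<open>a i\<close> at once lands in a product of compact sets. The image of \<open>F\<close> has a
  cluster point there, and pulling its neighbourhoods back makes every coordinate converge.\<close>

lemma convergent_refinement_exists: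
  fixes F :: "'i filter"
  assumes "F \<noteq> bot"
  obtains H where "H \<noteq> bot" "H \<le> F"
    "\<And>a :: 'i \<Rightarrow> real. bounded (range a) \<Longrightarrow> \<exists>l. (a \<longlongrightarrow> l) H"
proof -
  \<comment> \<open>Every family \<open>a\<close> is a coordinate. The unbounded ones get the factor
    \<open>{0}\<close> and the value 0, so that all factors are compact.\<close>
  define S :: "('i \<Rightarrow> real) \<Rightarrow> real set"
    where "S a = (if bounded (range a) then closure (range a) else {0})" for a
  define \<delta> :: "'i \<Rightarrow> ('i \<Rightarrow> real) \<Rightarrow> real"
    where "\<delta> i a = (if bounded (range a) then a i else 0)" for i a
  have "compact (S a)" for a
    by (auto simp: S_def compact_closure)
  then have "compactin (product_topology (\<lambda>a. euclidean) UNIV) (Pi\<^sub>E UNIV S)"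
    unfolding compactin_PiE by simp
  then have cpt: "compact (Pi\<^sub>E UNIV S)"
    by (simp add: euclidean_product_topology)
  have "\<delta> i \<in> Pi\<^sub>E UNIV S" for i
    using closure_subset by (fastforce simp: S_def \<delta>_def)
  then obtain \<phi> where \<phi>: "inf (nhds \<phi>) (filtermap \<delta> F) \<noteq> bot"
    using cpt[unfolded compact_filter, rule_format, of "filtermap \<delta> F"] assms
    by (auto simp: eventually_filtermap filtermap_bot_iff)
  define H where "H = inf F (filtercomap \<delta> (nhds \<phi>))"
  \<comment> \<open>If \<open>H\<close> were trivial, some property \<open>Q\<close> holding
    eventually in \<open>F\<close> would have an image under \<open>\<delta>\<close> that misses a
    neighbourhood of \<open>\<phi>\<close>, which contradicts the choice of \<open>\<phi>\<close> as
    a cluster point.\<close>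
  have "H \<noteq> bot"
  proof
    assume "H = bot"
    then obtain Q R where Q: "eventually Q F" and R: "eventually R (nhds \<phi>)"
      and QR: "\<And>i. Q i \<Longrightarrow> R (\<delta> i) \<Longrightarrow> False"
      unfolding H_def trivial_limit_def eventually_inf eventually_filtercomap by metis
    have "eventually (\<lambda>\<psi>. \<exists>i. Q i \<and> \<psi> = \<delta> i) (filtermap \<delta> F)"
      using Q unfolding eventually_filtermap by (rule eventually_mono) blast
    then have "eventually (\<lambda>\<psi>. False) (inf (nhds \<phi>) (filtermap \<delta> F))"
      unfolding eventually_inf using R QR by blast
    then show False
      using \<phi> by (simp add: trivial_limit_def)
  qed
  moreover have "H \<le> F"
    by (simp add: H_def)
  moreover have "\<exists>l. (a \<longlongrightarrow> l) H" if a: "bounded (range a)" for a :: "'i \<Rightarrow> real"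
  proof -
    \<comment> \<open>Projections of the product are continuous, so a bounded \<open>a\<close>
      converges along \<open>H\<close> to the coordinate \<open>\<phi> a\<close>.\<close>
    have "continuous_on UNIV (\<lambda>\<psi>::('i \<Rightarrow> real) \<Rightarrow> real. \<psi> a)"
      by simp
    then have "((\<lambda>\<psi>. \<psi> a) \<longlongrightarrow> \<phi> a) (nhds \<phi>)"
      using tendsto_at_iff_tendsto_nhds[of "\<lambda>\<psi>. \<psi> a" \<phi>] by (simp add: continuous_on_def)
    moreover have "filterlim \<delta> (nhds \<phi>) H"
      unfolding H_def by (rule filterlim_mono[OF filterlim_filtercomap order_refl inf_le2])
    ultimately have "((\<lambda>i. \<delta> i a) \<longlongrightarrow> \<phi> a) H"
      by (rule filterlim_compose)
    then show ?thesis
      using a by (auto simp: \<delta>_def)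
  qed
  ultimately show thesis
    using that by blast
qed

section \<open>Disjoint sequences in infinite algebras of sets\<close>

text \<open>A member with infinitely many members inside it properly contains another of the same
  kind. The successive differences of the resulting descending chain are disjoint and
  nonempty.\<close>

lemma (in algebra) infinite_imp_disjoint_family:
  assumes "infinite M"
  obtains A :: "nat \<Rightarrow> 'a set" where "\<And>n. A n \<in> M" "disjoint_family A" "\<And>n. A n \<noteq> {}"
proof -
  let ?big = "\<lambda>A. A \<in> M \<and> infinite {B \<in> M. B \<subseteq> A}"
  have step: "\<exists>B. ?big B \<and> B \<subset> A" if A: "?big A" for A
  proof -
    \<comment> \<open>An infinite collection is not exhausted by the two trivial members, so some
      \<open>C\<close> splits \<open>A\<close> properly.\<close>
    have "\<not> {B \<in> M. B \<subseteq> A} \<subseteq> {{}, A}"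
      using A finite_subset by blast
    then obtain C where C: "C \<in> M" "C \<subseteq> A" "C \<noteq> {}" "C \<noteq> A"
      by blast
    \<comment> \<open>Each \<open>B\<close> inside \<open>A\<close> is recovered from its traces
      \<open>B \<inter> C\<close> and \<open>B - C\<close>, so finitely many traces on both sides
      would leave only finitely many \<open>B\<close>.\<close>
    have "infinite {B \<in> M. B \<subseteq> C} \<or> infinite {B \<in> M. B \<subseteq> A - C}"
    proof (rule ccontr)
      assume "\<not> ?thesis"
      then have fin: "finite ((\<lambda>(U, V). U \<union> V) ` ({B \<in> M. B \<subseteq> C} \<times> {B \<in> M. B \<subseteq> A - C}))"
        by blast
      have "B \<in> (\<lambda>(U, V). U \<union> V) ` ({B \<in> M. B \<subseteq> C} \<times> {B \<in> M. B \<subseteq> A - C})"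
        if "B \<in> M" "B \<subseteq> A" for B
        using that C by (intro image_eqI[of _ _ "(B \<inter> C, B - C)"]) auto
      then have "{B \<in> M. B \<subseteq> A} \<subseteq> (\<lambda>(U, V). U \<union> V) ` ({B \<in> M. B \<subseteq> C} \<times> {B \<in> M. B \<subseteq> A - C})"
        by (intro subsetI) simp
      then show False
        using A finite_subset[OF _ fin] by simp
    qed
    moreover have "A - C \<in> M" "A - C \<subset> A" "C \<subset> A"
      using A C by auto
    ultimately show ?thesis
      using C by blast
  qed
  have "{B \<in> M. B \<subseteq> \<Omega>} = M"
    using sets_into_space by blast
  then have "?big \<Omega>"
    using assms by simp
  then have "\<exists>D. \<forall>n::nat. ?big (D n) \<and> D (Suc n) \<subset> D n"
    using step by (intro dependent_nat_choice[of "\<lambda>_. ?big"]) (rule exI)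
  then obtain D :: "nat \<Rightarrow> 'a set" where D': "\<forall>n. ?big (D n) \<and> D (Suc n) \<subset> D n" ..
  have D: "D n \<in> M" "D (Suc n) \<subset> D n" for n
    using D'[rule_format, of n] by simp_all
  \<comment> \<open>\<open>disjoint_family_Suc\<close> is about increasing sequences, hence the
    passage to complements.\<close>
  have "- D n \<subseteq> - D (Suc n)" for n
    using D(2)[of n] by blast
  then have "disjoint_family (\<lambda>n. - D (Suc n) - - D n)"
    by (rule disjoint_family_Suc[of "\<lambda>n. - D n"])
  moreover have "- D (Suc n) - - D n = D n - D (Suc n)" for n
    by blast
  ultimately have "disjoint_family (\<lambda>n. D n - D (Suc n))"
    by simp
  then show thesis
    using that[of "\<lambda>n. D n - D (Suc n)"] D by blast
qed

section \<open>Finite linear combinations under pointwise operations\<close>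

text \<open>Bounded measurable functions and the dual of a normed space both have pointwise
  operations, and this serves both. Membership and the value of \<open>\<phi>\<close> go through one
  induction, because additivity is available only inside the carrier.\<close>

lemma bounded_functional_pointwise_sum:
  fixes E :: "('a \<Rightarrow> real) normed_str"
  assumes zero: "(\<lambda>x\<in>X. 0) \<in> vectors E"
    and vadd: "vadd E = (\<lambda>f g. \<lambda>x\<in>X. f x + g x)"
    and vscale: "vscale E = (\<lambda>c f. \<lambda>x\<in>X. c * f x)"
    and add_closed: "\<And>f g. f \<in> vectors E \<Longrightarrow> g \<in> vectors E \<Longrightarrow> vadd E f g \<in> vectors E"
    and scale_closed: "\<And>c f. f \<in> vectors E \<Longrightarrow> vscale E c f \<in> vectors E"
    and "finite I" and "\<And>i. i \<in> I \<Longrightarrow> g i \<in> vectors E"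
  shows "(\<lambda>x\<in>X. \<Sum>i\<in>I. a i * g i x) \<in> vectors E \<and>
    (bounded_functional E \<phi> \<longrightarrow> \<phi> (\<lambda>x\<in>X. \<Sum>i\<in>I. a i * g i x) = (\<Sum>i\<in>I. a i * \<phi> (g i)))"
  using assms(6,7)
proof (induction I rule: finite_induct)
  case empty
  have "\<phi> (\<lambda>x\<in>X. 0) = 0" if "bounded_functional E \<phi>"
  proof -
    \<comment> \<open>The value at zero comes from homogeneity, by scaling the zero function by
      0.\<close>
    have "\<phi> (vscale E 0 (\<lambda>x\<in>X. 0)) = 0 * \<phi> (\<lambda>x\<in>X. 0)"
      using that zero unfolding bounded_functional_def by blast
    then show ?thesis
      by (simp add: vscale cong: restrict_cong)
  qed
  then show ?case
    using zero by (simp only: sum.empty) blast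
next
  case (insert j J)
  define f where "f = (\<lambda>x\<in>X. \<Sum>i\<in>J. a i * g i x)"
  have eq: "(\<lambda>x\<in>X. \<Sum>i\<in>insert j J. a i * g i x) = vadd E (vscale E (a j) (g j)) f"
    using insert.hyps by (auto simp: vadd vscale f_def)
  have g: "g j \<in> vectors E" and f: "f \<in> vectors E"
    and \<phi>f: "bounded_functional E \<phi> \<Longrightarrow> \<phi> f = (\<Sum>i\<in>J. a i * \<phi> (g i))"
    using insert unfolding f_def by blast+
  have "\<phi> (vadd E (vscale E (a j) (g j)) f) = a j * \<phi> (g j) + \<phi> f" if "bounded_functional E \<phi>"
    using that g f scale_closed[OF g] unfolding bounded_functional_def by metis
  then show ?case
    unfolding eq using insert.hyps f g \<phi>f add_closed scale_closed by simp
qed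

section \<open>Dual and bidual of a normed space\<close>

context real_normed_space
begin

lemma norm_zero: "vnorm E (vzero E) = 0"
  using norm_eq_zero zero_closed by blast

lemma norm_nonneg:
  assumes "x \<in> vectors E"
  shows "0 \<le> vnorm E x"
  using norm_triangle[OF assms scale_closed[OF assms, of "- 1"]] add_neg[OF assms]
    norm_scale[OF assms, of "- 1"] norm_zero by simp

text \<open>The dual norm is a supremum of reals, which dominates its values only if they are
  bounded above; the constant \<open>K\<close> of the bounded functional ensures this.\<close>

lemma dual_abs_le_norm:
  assumes \<phi>: "\<phi> \<in> vectors (dual_space E)" and x: "x \<in> vectors E" "vnorm E x \<le> 1"
  shows "\<bar>\<phi> x\<bar> \<le> vnorm (dual_space E) \<phi>"
proof -
  obtain K where K: "\<And>x. x \<in> vectors E \<Longrightarrow> \<bar>\<phi> x\<bar> \<le> K * vnorm E x"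
    using \<phi> unfolding dual_space_def bounded_functional_def by fastforce
  \<comment> \<open>\<open>K\<close> may be negative, hence its absolute value.\<close>
  have "\<bar>\<phi> y\<bar> \<le> \<bar>K\<bar>" if "y \<in> vectors E" "vnorm E y \<le> 1" for y
  proof -
    have "K * vnorm E y \<le> \<bar>K\<bar> * vnorm E y"
      using norm_nonneg[OF that(1)] by (intro mult_right_mono) auto
    also have "\<dots> \<le> \<bar>K\<bar> * 1"
      using that by (intro mult_left_mono) auto
    finally show ?thesis
      using K[OF that(1)] by linarith
  qed
  then have "bdd_above ((\<lambda>x. \<bar>\<phi> x\<bar>) ` {x \<in> vectors E. vnorm E x \<le> 1})"
    by (intro bdd_aboveI[of _ "\<bar>K\<bar>"]) auto
  then have "\<bar>\<phi> x\<bar> \<le> (SUP x\<in>{x \<in> vectors E. vnorm E x \<le> 1}. \<bar>\<phi> x\<bar>)"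
    using x by (intro cSUP_upper) auto
  then show ?thesis
    by (simp add: dual_space_def)
qed

text \<open>Rescaling \<open>x\<close> to norm 1 reduces to the unit ball; at norm 0 the boundedness
  of \<open>\<phi>\<close> forces \<open>\<phi> x = 0\<close>.\<close>

lemma dual_abs_le:
  assumes \<phi>: "\<phi> \<in> vectors (dual_space E)" and x: "x \<in> vectors E"
  shows "\<bar>\<phi> x\<bar> \<le> vnorm E x * vnorm (dual_space E) \<phi>"
proof (cases "vnorm E x = 0")
  case True
  obtain K where "\<bar>\<phi> x\<bar> \<le> K * vnorm E x"
    using \<phi> x unfolding dual_space_def bounded_functional_def by fastforce
  then show ?thesis
    using True by simp
next
  case False
  then have pos: "0 < vnorm E x"
    using norm_nonneg[OF x] by simp
  let ?y = "vscale E (inverse (vnorm E x)) x"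
  have "vnorm E ?y = 1"
    using norm_scale[OF x, of "inverse (vnorm E x)"] pos by simp
  then have "\<bar>\<phi> ?y\<bar> \<le> vnorm (dual_space E) \<phi>"
    using scale_closed[OF x] by (intro dual_abs_le_norm[OF \<phi>]) auto
  moreover have "\<phi> ?y = inverse (vnorm E x) * \<phi> x"
    using \<phi> x by (simp add: dual_space_def bounded_functional_def)
  ultimately have "\<bar>\<phi> x\<bar> / vnorm E x \<le> vnorm (dual_space E) \<phi>"
    using pos by (simp add: abs_mult divide_inverse mult.commute)
  then show ?thesis
    using pos by (simp add: field_simps)
qed

lemma dual_zero_closed: "(\<lambda>x\<in>vectors E. 0) \<in> vectors (dual_space E)"
  by (auto simp: dual_space_def bounded_functional_def add_closed scale_closed intro!: exI[of _ 0])

lemma dual_add_closed: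
  assumes \<phi>: "\<phi> \<in> vectors (dual_space E)" and \<psi>: "\<psi> \<in> vectors (dual_space E)"
  shows "vadd (dual_space E) \<phi> \<psi> \<in> vectors (dual_space E)"
proof -
  have "\<bar>\<phi> x + \<psi> x\<bar> \<le> (vnorm (dual_space E) \<phi> + vnorm (dual_space E) \<psi>) * vnorm E x"
    if "x \<in> vectors E" for x
    using dual_abs_le[OF \<phi> that] dual_abs_le[OF \<psi> that] by (simp add: algebra_simps)
  then have "\<exists>K. \<forall>x\<in>vectors E. \<bar>\<phi> x + \<psi> x\<bar> \<le> K * vnorm E x"
    by blast
  then show ?thesis
    using \<phi> \<psi>
    by (simp add: dual_space_def bounded_functional_def add_closed scale_closed algebra_simps)
qed

lemma dual_scale_closed:
  assumes \<phi>: "\<phi> \<in> vectors (dual_space E)"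
  shows "vscale (dual_space E) c \<phi> \<in> vectors (dual_space E)"
proof -
  have "\<bar>c * \<phi> x\<bar> \<le> (\<bar>c\<bar> * vnorm (dual_space E) \<phi>) * vnorm E x" if "x \<in> vectors E" for x
    using mult_left_mono[OF dual_abs_le[OF \<phi> that], of "\<bar>c\<bar>"] by (simp add: abs_mult algebra_simps)
  then have "\<exists>K. \<forall>x\<in>vectors E. \<bar>c * \<phi> x\<bar> \<le> K * vnorm E x"
    by blast
  then show ?thesis
    using \<phi> by (simp add: dual_space_def bounded_functional_def add_closed scale_closed algebra_simps)
qed

text \<open>This is the half of reflexivity that holds in every normed space;
  \<open>vnorm E x\<close> bounds the evaluation at \<open>x\<close> by
  \<open>dual_abs_le\<close>.\<close>

lemma canonical_embedding_in_bidual: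
  assumes x: "x \<in> vectors E"
  shows "canonical_embedding E x \<in> vectors (dual_space (dual_space E))"
proof -
  have ev: "canonical_embedding E x \<phi> = \<phi> x" if "\<phi> \<in> vectors (dual_space E)" for \<phi>
    using that by (simp add: canonical_embedding_def)
  have "bounded_functional (dual_space E) (canonical_embedding E x)"
    unfolding bounded_functional_def
  proof (intro conjI ballI allI)
    show "canonical_embedding E x \<in> extensional (vectors (dual_space E))"
      by (simp add: canonical_embedding_def)
    show "\<exists>K. \<forall>\<phi>\<in>vectors (dual_space E).
        \<bar>canonical_embedding E x \<phi>\<bar> \<le> K * vnorm (dual_space E) \<phi>"
      using dual_abs_le[OF _ x] by (intro exI[of _ "vnorm E x"]) (simp add: ev)
    fix \<phi> assume \<phi>: "\<phi> \<in> vectors (dual_space E)"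
    show "canonical_embedding E x (vscale (dual_space E) c \<phi>) = c * canonical_embedding E x \<phi>" for c
      unfolding ev[OF \<phi>] ev[OF dual_scale_closed[OF \<phi>]] using x by (simp add: dual_space_def)
    show "canonical_embedding E x (vadd (dual_space E) \<phi> \<psi>) =
        canonical_embedding E x \<phi> + canonical_embedding E x \<psi>"
      if \<psi>: "\<psi> \<in> vectors (dual_space E)" for \<psi>
      unfolding ev[OF \<phi>] ev[OF \<psi>] ev[OF dual_add_closed[OF \<phi> \<psi>]] using x by (simp add: dual_space_def)
  qed
  then show ?thesis
    by (simp add: dual_space_def[of "dual_space E"])
qed

text \<open>The operations of the dual are pointwise on \<open>vectors E\<close>, so the summation
  lemma applies with that set in the role of \<open>X\<close>.\<close>

lemma bidual_sum:
  assumes F: "F \<in> vectors (dual_space (dual_space E))"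
    and "finite I" "\<And>i. i \<in> I \<Longrightarrow> \<psi> i \<in> vectors (dual_space E)"
  shows "F (\<lambda>x\<in>vectors E. \<Sum>i\<in>I. a i * \<psi> i x) = (\<Sum>i\<in>I. a i * F (\<psi> i))"
proof -
  have "bounded_functional (dual_space E) F"
    using F by (simp add: dual_space_def[of "dual_space E"])
  then show ?thesis
    using bounded_functional_pointwise_sum[of "vectors E" "dual_space E" I \<psi> a F]
      dual_zero_closed dual_add_closed dual_scale_closed assms
    by (simp add: dual_space_def[of E])
qed

end

section \<open>Bounded measurable functions and functionals on them\<close>

context sigma_algebra
begin

abbreviation "bm \<equiv> bounded_measurable_space \<Omega> M"

lemma bm_mem_iff:
  "f \<in> vectors bm \<longleftrightarrow>
    f \<in> extensional \<Omega> \<and> f \<in> borel_measurable (sigma \<Omega> M) \<and> bounded (f ` \<Omega>)"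
  by (simp add: bounded_measurable_space_def)

lemma bm_indicator:
  assumes "A \<in> M"
  shows "restrict (indicator A) \<Omega> \<in> vectors bm"
proof -
  have "(indicator A :: 'a \<Rightarrow> real) \<in> borel_measurable (sigma \<Omega> M)"
    using assms by (intro borel_measurable_indicator) (simp add: sets_measure_of_eq)
  then have "(restrict (indicator A) \<Omega> :: 'a \<Rightarrow> real) \<in> borel_measurable (sigma \<Omega> M)"
    by (subst measurable_cong[where g = "indicator A"]) (auto simp: space_measure_of_conv)
  moreover have "bounded ((restrict (indicator A) \<Omega> :: 'a \<Rightarrow> real) ` \<Omega>)"
    by (rule boundedI[of _ 1]) (auto simp: indicator_def)
  ultimately show ?thesis
    by (simp add: bm_mem_iff)
qed

lemma bm_normed:
  assumes "\<Omega> \<noteq> {}"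
  shows "real_normed_space bm"
  using real_banach_space_bounded_measurable_space[OF sigma_algebra_axioms assms]
  by (simp add: real_banach_space_def)

lemma bm_abs_le:
  assumes "f \<in> vectors bm" "x \<in> \<Omega>"
  shows "\<bar>f x\<bar> \<le> vnorm bm f"
  using bounded_measurable_space_norm_le_iff[of \<Omega> f M "vnorm bm f"] assms by auto

lemma bm_sum:
  assumes "\<Omega> \<noteq> {}" "finite I" "\<And>i. i \<in> I \<Longrightarrow> g i \<in> vectors bm"
  shows "(\<lambda>x\<in>\<Omega>. \<Sum>i\<in>I. a i * g i x) \<in> vectors bm"
    and "\<phi> \<in> vectors (dual_space bm) \<Longrightarrow>
      \<phi> (\<lambda>x\<in>\<Omega>. \<Sum>i\<in>I. a i * g i x) = (\<Sum>i\<in>I. a i * \<phi> (g i))"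
proof -
  interpret real_normed_space bm
    by (rule bm_normed[OF assms(1)])
  have "(\<lambda>x\<in>\<Omega>. 0) \<in> vectors bm"
    using zero_closed by (simp add: bounded_measurable_space_def)
  then have *: "(\<lambda>x\<in>\<Omega>. \<Sum>i\<in>I. a i * g i x) \<in> vectors bm \<and> (bounded_functional bm \<phi> \<longrightarrow>
      \<phi> (\<lambda>x\<in>\<Omega>. \<Sum>i\<in>I. a i * g i x) = (\<Sum>i\<in>I. a i * \<phi> (g i)))" for \<phi>
    using add_closed scale_closed assms(2,3)
    by (intro bounded_functional_pointwise_sum) (simp_all add: bounded_measurable_space_def)
  then show "(\<lambda>x\<in>\<Omega>. \<Sum>i\<in>I. a i * g i x) \<in> vectors bm"
    by blast
  show "\<phi> \<in> vectors (dual_space bm) \<Longrightarrow>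
      \<phi> (\<lambda>x\<in>\<Omega>. \<Sum>i\<in>I. a i * g i x) = (\<Sum>i\<in>I. a i * \<phi> (g i))"
    using * by (simp add: dual_space_def)
qed

text \<open>Limits respect sums, multiples and bounds. A constant \<open>x\<close> gives point
  evaluations; a filter from \<open>convergent_refinement_exists\<close> gives generalised limits
  along a sequence of points.\<close>

lemma bm_limit_functional:
  assumes "\<Omega> \<noteq> {}" and H: "H \<noteq> bot" and x: "\<And>i. x i \<in> \<Omega>"
    and lim: "\<And>f. f \<in> vectors bm \<Longrightarrow> ((\<lambda>i. f (x i)) \<longlongrightarrow> L f) H"
  shows "restrict L (vectors bm) \<in> vectors (dual_space bm)"
proof -
  interpret real_normed_space bm
    by (rule bm_normed[OF assms(1)])
  have "bounded_functional bm (restrict L (vectors bm))"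
    unfolding bounded_functional_def
  proof (intro conjI ballI allI)
    \<comment> \<open>Point values are bounded by the supremum norm and limits preserve this, so 1
      serves as the constant.\<close>
    have "\<bar>L f\<bar> \<le> vnorm bm f" if f: "f \<in> vectors bm" for f
      using H tendsto_rabs[OF lim[OF f]] bm_abs_le[OF f x] by (intro tendsto_upperbound) auto
    then show "\<exists>K. \<forall>f\<in>vectors bm. \<bar>restrict L (vectors bm) f\<bar> \<le> K * vnorm bm f"
      by (intro exI[of _ 1]) simp
    fix f assume f: "f \<in> vectors bm"
    have "((\<lambda>i. vscale bm c f (x i)) \<longlongrightarrow> c * L f) H" for c
      using tendsto_mult_left[OF lim[OF f], of c] x by (simp add: bounded_measurable_space_def)
    then have "L (vscale bm c f) = c * L f" for c
      using tendsto_unique[OF H lim[OF scale_closed[OF f]]] by blast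
    then show "restrict L (vectors bm) (vscale bm c f) = c * restrict L (vectors bm) f" for c
      using f scale_closed by simp
    fix g assume g: "g \<in> vectors bm"
    have "((\<lambda>i. vadd bm f g (x i)) \<longlongrightarrow> L f + L g) H"
      using tendsto_add[OF lim[OF f] lim[OF g]] x by (simp add: bounded_measurable_space_def)
    then have "L (vadd bm f g) = L f + L g"
      using tendsto_unique[OF H lim[OF add_closed[OF f g]]] by blast
    then show "restrict L (vectors bm) (vadd bm f g) =
        restrict L (vectors bm) f + restrict L (vectors bm) g"
      using f g add_closed by simp
  qed simp
  then show ?thesis
    by (simp add: dual_space_def)
qed

lemma bm_eval_functional:
  assumes "x \<in> \<Omega>"
  shows "(\<lambda>f\<in>vectors bm. f x) \<in> vectors (dual_space bm)"
  using assms by (intro bm_limit_functional[of sequentially "\<lambda>_. x" "\<lambda>f. f x"]) auto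

section \<open>Finite sigma-algebras: atoms, dual basis and reflexivity\<close>

lemma finite_imp_bm_finite_basis:
  assumes "finite M"
  obtains P e where "finite P" "P \<subseteq> \<Omega>" "\<And>p. p \<in> P \<Longrightarrow> e p \<in> vectors bm"
    "\<And>f. f \<in> vectors bm \<Longrightarrow> f = (\<lambda>x\<in>\<Omega>. \<Sum>p\<in>P. f p * e p x)"
proof -
  \<comment> \<open>Two points lie in the same atom exactly when the same members of
    \<open>M\<close> contain them, so atoms are the fibres of \<open>s\<close> on
    \<open>\<Omega>\<close>.\<close>
  define s where "s x = {A \<in> M. x \<in> A}" for x
  define atom where "atom p = {x \<in> \<Omega>. s x = s p}" for p
  \<comment> \<open>\<open>P\<close> picks one point from each atom.\<close>
  obtain P where P: "P \<subseteq> \<Omega>" "inj_on s P" "s ` \<Omega> = s ` P"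
    using iffD1[OF subset_image_inj order_refl[of "s ` \<Omega>"]] by metis
  have "s ` P \<subseteq> Pow M"
    by (auto simp: s_def)
  then have fin: "finite P"
    using assms P(2) finite_imageD finite_subset by blast
  have atom: "atom p \<in> M" if p: "p \<in> \<Omega>" for p
  proof -
    have "atom p = \<Inter> (s p)"
    proof (intro equalityI subsetI)
      fix x assume x: "x \<in> \<Inter> (s p)"
      then have "x \<in> \<Omega>"
        using p by (auto simp: s_def)
      \<comment> \<open>If \<open>p\<close> were outside \<open>A\<close>, the complement of
        \<open>A\<close> would belong to \<open>s p\<close> and hence contain
        \<open>x\<close>.\<close>
      moreover have "p \<in> A" if "A \<in> M" "x \<in> A" for A
        using that x p compl_sets[of A] by (auto simp: s_def)
      ultimately show "x \<in> atom p"
        using x by (auto simp: atom_def s_def)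
    qed (auto simp: atom_def s_def)
    moreover have "finite (s p)" "s p \<noteq> {}" "s p \<subseteq> M"
      using assms p by (auto simp: s_def)
    ultimately show ?thesis
      using finite_INT[of "s p" "\<lambda>A. A"] by auto
  qed
  define e :: "'a \<Rightarrow> 'a \<Rightarrow> real" where "e p = restrict (indicator (atom p)) \<Omega>" for p
  have "f x = (\<Sum>p\<in>P. f p * e p x)" if f: "f \<in> vectors bm" and x: "x \<in> \<Omega>" for f x
  proof -
    obtain q where q: "q \<in> P" "s x = s q"
      using P(3) x by blast
    \<comment> \<open>The level set of \<open>f\<close> through \<open>q\<close> is measurable and
      contains \<open>q\<close>. Since \<open>s x = s q\<close>, it also contains \<open>x\<close>,
      so \<open>f\<close> is constant on atoms.\<close>
    have "f -` {f q} \<inter> space (sigma \<Omega> M) \<in> sets (sigma \<Omega> M)"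
      using f unfolding bm_mem_iff by (intro measurable_sets) auto
    then have "f -` {f q} \<inter> \<Omega> \<in> M"
      by (simp add: sets_measure_of_eq space_measure_of_eq)
    then have "f -` {f q} \<inter> \<Omega> \<in> s q"
      using q P by (auto simp: s_def)
    then have "f x = f q"
      unfolding q(2)[symmetric] by (auto simp: s_def)
    moreover have "f p * e p x = (if p = q then f q else 0)" if "p \<in> P" for p
      using that q x P(2) by (auto simp: e_def atom_def indicator_def inj_on_def)
    ultimately show ?thesis
      using fin q(1) by (simp cong: sum.cong)
  qed
  then have "f = (\<lambda>x\<in>\<Omega>. \<Sum>p\<in>P. f p * e p x)" if "f \<in> vectors bm" for f
    using that by (intro extensionalityI[of f \<Omega>]) (auto simp: bm_mem_iff)
  moreover have "e p \<in> vectors bm" if "p \<in> P" for p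
    unfolding e_def using that P(1) by (intro bm_indicator atom) auto
  ultimately show thesis
    using that fin P(1) by blast
qed

lemma finite_imp_bm_reflexive:
  assumes "finite M" "\<Omega> \<noteq> {}"
  shows "reflexive_space bm"
proof -
  interpret real_normed_space bm
    by (rule bm_normed[OF assms(2)])
  obtain P e where P: "finite P" "P \<subseteq> \<Omega>" and e: "\<And>p. p \<in> P \<Longrightarrow> e p \<in> vectors bm"
    and basis: "\<And>f. f \<in> vectors bm \<Longrightarrow> f = (\<lambda>x\<in>\<Omega>. \<Sum>p\<in>P. f p * e p x)"
    using finite_imp_bm_finite_basis[OF assms(1)] by blast
  define \<delta> where "\<delta> p = (\<lambda>f\<in>vectors bm. f p)" for p
  have \<delta>: "\<delta> p \<in> vectors (dual_space bm)" if "p \<in> P" for p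
    using that P bm_eval_functional by (auto simp: \<delta>_def)
  have "F \<in> canonical_embedding bm ` vectors bm" if F: "F \<in> vectors (dual_space (dual_space bm))" for F
  proof
    \<comment> \<open>The values of \<open>F\<close> at the point evaluations are the coordinates of
      the vector that represents \<open>F\<close>.\<close>
    let ?v = "\<lambda>x\<in>\<Omega>. \<Sum>p\<in>P. F (\<delta> p) * e p x"
    show "?v \<in> vectors bm"
      by (rule bm_sum(1)[OF assms(2) P(1) e])
    have "F \<phi> = \<phi> ?v" if \<phi>: "\<phi> \<in> vectors (dual_space bm)" for \<phi>
    proof -
      \<comment> \<open>Applying \<open>\<phi>\<close> to the expansion of \<open>f\<close> writes
        \<open>\<phi>\<close> as a finite combination of point evaluations, on which
        \<open>F\<close> can be computed.\<close>
      have "\<phi> f = (\<Sum>p\<in>P. \<phi> (e p) * \<delta> p f)" if f: "f \<in> vectors bm" for f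
        using arg_cong[OF basis[OF f], of \<phi>] bm_sum(2)[OF assms(2) P(1) e \<phi>, where a = f] f
        by (simp add: \<delta>_def mult.commute)
      then have "\<phi> = (\<lambda>f\<in>vectors bm. \<Sum>p\<in>P. \<phi> (e p) * \<delta> p f)"
        using \<phi> by (intro extensionalityI[of \<phi> "vectors bm"])
          (auto simp: dual_space_def bounded_functional_def)
      then have "F \<phi> = F (\<lambda>f\<in>vectors bm. \<Sum>p\<in>P. \<phi> (e p) * \<delta> p f)"
        by (rule arg_cong)
      also have "\<dots> = (\<Sum>p\<in>P. \<phi> (e p) * F (\<delta> p))"
        by (rule bidual_sum[OF F P(1) \<delta>])
      also have "\<dots> = \<phi> ?v"
        using bm_sum(2)[OF assms(2) P(1) e \<phi>, where a = "\<lambda>p. F (\<delta> p)"] by (simp add: mult.commute)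
      finally show ?thesis .
    qed
    then show "F = canonical_embedding bm ?v"
      using F by (intro extensionalityI[of F "vectors (dual_space bm)"])
        (auto simp: dual_space_def[of "dual_space bm"] bounded_functional_def canonical_embedding_def)
  qed
  then show ?thesis
    unfolding reflexive_space_def using canonical_embedding_in_bidual by blast
qed

section \<open>Infinite sigma-algebras: a bidual element outside the canonical image\<close>

text \<open>Test \<open>\<phi>\<close> on the combination of the indicators with coefficients the
  signs of its values. Disjointness keeps the norm of this combination at most 1.\<close>

lemma dual_indicator_sum_le:
  assumes "\<Omega> \<noteq> {}" and A: "\<And>n::nat. A n \<in> M" "disjoint_family A"
    and \<phi>: "\<phi> \<in> vectors (dual_space bm)"
  shows "(\<Sum>n<N. \<bar>\<phi> (restrict (indicator (A n)) \<Omega>)\<bar>) \<le> vnorm (dual_space bm) \<phi>"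
proof -
  interpret real_normed_space bm
    by (rule bm_normed[OF assms(1)])
  define e :: "nat \<Rightarrow> 'a \<Rightarrow> real" where "e n = restrict (indicator (A n)) \<Omega>" for n
  let ?g = "\<lambda>x\<in>\<Omega>. \<Sum>n<N. sgn (\<phi> (e n)) * e n x"
  have e: "e n \<in> vectors bm" for n
    unfolding e_def by (rule bm_indicator[OF A(1)])
  have g: "?g \<in> vectors bm"
    by (rule bm_sum(1)[OF assms(1) finite_lessThan e])
  \<comment> \<open>At most one term is nonzero at \<open>x\<close>, and it is a sign.\<close>
  have "\<bar>?g x\<bar> \<le> 1" if x: "x \<in> \<Omega>" for x
  proof (cases "\<exists>m<N. x \<in> A m")
    case True
    then obtain m where m: "m < N" "x \<in> A m"
      by blast
    have "e n x = (if n = m then 1 else 0)" for n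
      using A(2) m x by (auto simp: e_def disjoint_family_on_def indicator_def)
    then have "sgn (\<phi> (e n)) * e n x = (if n = m then sgn (\<phi> (e m)) else 0)" for n
      by simp
    then have "?g x = sgn (\<phi> (e m))"
      using m x by simp
    then show ?thesis
      by (simp only: abs_sgn_eq) simp
  next
    case False
    then have "?g x = 0"
      using x by (auto simp: e_def intro!: sum.neutral)
    then show ?thesis
      by linarith
  qed
  then have "vnorm bm ?g \<le> 1"
    using bounded_measurable_space_norm_le_iff[OF assms(1) g] by blast
  then have "\<bar>\<phi> ?g\<bar> \<le> vnorm (dual_space bm) \<phi>"
    by (rule dual_abs_le_norm[OF \<phi> g])
  moreover have "\<phi> ?g = (\<Sum>n<N. \<bar>\<phi> (e n)\<bar>)"
    using bm_sum(2)[OF assms(1) finite_lessThan _ \<phi>, where g = e and a = "\<lambda>n. sgn (\<phi> (e n))"] e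
    by (simp add: abs_sgn mult.commute)
  ultimately show ?thesis
    by (simp add: e_def)
qed

lemma bm_reflexive_imp_finite:
  assumes "reflexive_space bm" "\<Omega> \<noteq> {}"
  shows "finite M"
proof (rule ccontr)
  assume "infinite M"
  then obtain A :: "nat \<Rightarrow> 'a set"
    where A: "\<And>n. A n \<in> M" "disjoint_family A" and ne: "\<And>n. A n \<noteq> {}"
    using infinite_imp_disjoint_family by metis
  interpret real_normed_space bm
    by (rule bm_normed[OF assms(2)])
  define D where "D = dual_space bm"
  define e :: "nat \<Rightarrow> 'a \<Rightarrow> real" where "e n = restrict (indicator (A n)) \<Omega>" for n
  have e: "e n \<in> vectors bm" for n
    unfolding e_def by (rule bm_indicator[OF A(1)])
  define F where "F = (\<lambda>\<phi>\<in>vectors D. \<Sum>n. \<phi> (e n))"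
  \<comment> \<open>This one bound gives absolute convergence of the series in \<open>F\<close> and
    also the constant 1 for \<open>F\<close>.\<close>
  have le: "(\<Sum>n<N. \<bar>\<phi> (e n)\<bar>) \<le> vnorm D \<phi>" if "\<phi> \<in> vectors D" for \<phi> N
    using dual_indicator_sum_le[OF assms(2) A, of \<phi> N] that by (simp add: D_def e_def)
  have abs_summable: "summable (\<lambda>n. \<bar>\<phi> (e n)\<bar>)" if "\<phi> \<in> vectors D" for \<phi>
    using le[OF that] by (intro bounded_imp_summable[of _ "vnorm D \<phi>"])
      (simp_all only: abs_ge_zero flip: lessThan_Suc_atMost)
  have summable: "summable (\<lambda>n. \<phi> (e n))" if "\<phi> \<in> vectors D" for \<phi>
    using abs_summable[OF that] by (rule summable_rabs_cancel)
  have "bounded_functional D F"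
    unfolding bounded_functional_def
  proof (intro conjI ballI allI)
    show "F \<in> extensional (vectors D)"
      by (simp add: F_def)
    have "\<bar>F \<phi>\<bar> \<le> vnorm D \<phi>" if \<phi>: "\<phi> \<in> vectors D" for \<phi>
    proof -
      have "\<bar>F \<phi>\<bar> \<le> (\<Sum>n. \<bar>\<phi> (e n)\<bar>)"
        using summable_rabs[OF abs_summable[OF \<phi>]] \<phi> by (simp add: F_def)
      also have "\<dots> \<le> vnorm D \<phi>"
        by (rule suminf_le_const[OF abs_summable[OF \<phi>] le[OF \<phi>]])
      finally show ?thesis .
    qed
    then show "\<exists>K. \<forall>\<phi>\<in>vectors D. \<bar>F \<phi>\<bar> \<le> K * vnorm D \<phi>"
      by (intro exI[of _ 1]) simp
    fix \<phi> assume \<phi>: "\<phi> \<in> vectors D"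
    have "vscale D c \<phi> (e n) = c * \<phi> (e n)" for c n
      using e by (simp add: D_def dual_space_def)
    then show "F (vscale D c \<phi>) = c * F \<phi>" for c
      using \<phi> dual_scale_closed[of \<phi> c] suminf_mult[OF summable[OF \<phi>]] by (simp add: F_def D_def)
    fix \<psi> assume \<psi>: "\<psi> \<in> vectors D"
    have "vadd D \<phi> \<psi> (e n) = \<phi> (e n) + \<psi> (e n)" for n
      using e by (simp add: D_def dual_space_def)
    then show "F (vadd D \<phi> \<psi>) = F \<phi> + F \<psi>"
      using \<phi> \<psi> dual_add_closed[of \<phi> \<psi>] suminf_add[OF summable[OF \<phi>] summable[OF \<psi>]]
      by (simp add: F_def D_def)
  qed
  then have "F \<in> vectors (dual_space (dual_space bm))"
    by (simp add: dual_space_def[of "dual_space bm"] D_def)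
  then obtain f where f: "f \<in> vectors bm" and F: "F = canonical_embedding bm f"
    using assms(1) unfolding reflexive_space_def by blast
  \<comment> \<open>This identity is tested twice: on the evaluations at the points
    \<open>x n\<close>, and on the generalised limit \<open>L\<close>.\<close>
  have Ff: "\<phi> f = (\<Sum>n. \<phi> (e n))" if "\<phi> \<in> vectors D" for \<phi>
    using fun_cong[OF F, of \<phi>] that by (simp add: F_def D_def canonical_embedding_def)
  have "\<exists>x. x \<in> A n" for n
    using ne by blast
  then obtain x where x: "\<And>n. x n \<in> A n"
    by metis
  then have x\<Omega>: "x n \<in> \<Omega>" for n
    using A(1) sets_into_space by blast
  have ex: "e k (x n) = (if k = n then 1 else 0)" for k n
    using x[of n] x\<Omega>[of n] A(2) by (auto simp: e_def disjoint_family_on_def indicator_def)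
  have fx: "f (x n) = 1" for n
  proof -
    have "f (x n) = (\<Sum>k. e k (x n))"
      using Ff[of "\<lambda>f\<in>vectors bm. f (x n)"] bm_eval_functional[OF x\<Omega>, of n] f e by (simp add: D_def)
    also have "\<dots> = 1"
      using suminf_finite[of "{n}" "\<lambda>k. e k (x n)"] by (simp add: ex)
    finally show ?thesis .
  qed
  \<comment> \<open>Refining \<open>sequentially\<close> makes \<open>L\<close> ignore finitely many
    indices while every bounded sequence still has a limit.\<close>
  obtain H :: "nat filter" where H: "H \<noteq> bot" "H \<le> sequentially"
    and conv: "\<And>a :: nat \<Rightarrow> real. bounded (range a) \<Longrightarrow> \<exists>l. (a \<longlongrightarrow> l) H"
    using convergent_refinement_exists[of sequentially] by auto
  have "\<exists>l. ((\<lambda>n. g (x n)) \<longlongrightarrow> l) H" if "g \<in> vectors bm" for g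
    using that x\<Omega> by (intro conv) (auto simp: bm_mem_iff elim!: bounded_subset)
  then obtain L where L: "\<And>g. g \<in> vectors bm \<Longrightarrow> ((\<lambda>n. g (x n)) \<longlongrightarrow> L g) H"
    by metis
  have "L f = 1"
    using L[OF f] H(1) by (simp add: fx tendsto_const_iff)
  moreover have "L (e k) = 0" for k
  proof -
    \<comment> \<open>The point \<open>x n\<close> lies outside \<open>A k\<close> as soon as
      \<open>n > k\<close>.\<close>
    have "eventually (\<lambda>n. e k (x n) = 0) H"
      by (intro filter_leD[OF H(2)] eventually_mono[OF eventually_gt_at_top[of k]]) (simp add: ex)
    then have "((\<lambda>n. e k (x n)) \<longlongrightarrow> 0) H"
      by (rule tendsto_eventually)
    then show ?thesis
      using tendsto_unique[OF H(1) L[OF e]] by blast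
  qed
  \<comment> \<open>Here the left side is 1, whereas every term on the right is 0.\<close>
  moreover have "L f = (\<Sum>k. L (e k))"
    using Ff[of "restrict L (vectors bm)"] bm_limit_functional[OF assms(2) H(1), of x L] x\<Omega> L f e
    by (simp add: D_def)
  ultimately show False
    by simp
qed

end

theorem mainTheorem5:
  fixes X :: "'a set" and \<A> :: "'a set set"
  assumes "sigma_algebra X \<A>" and "X \<noteq> {}"
  shows "reflexive_space (bounded_measurable_space X \<A>) \<longleftrightarrow> finite \<A>"
  using sigma_algebra.bm_reflexive_imp_finite[OF assms(1) _ assms(2)]
    sigma_algebra.finite_imp_bm_reflexive[OF assms(1) _ assms(2)] by blast

end
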